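(* For every integer $n\ge1$, the number of cyclic permutations of $\{1,\dots,n\}$ whose excedances form an increasing subsequence equals $B_{n-1}$, the $(n-1)$st Bell number (the number of set partitions of an $(n-1)$-element set).
   Context: A permutation $\pi$ of $\{1,\dots,n\}$ is cyclic if it consists of a single cycle. An excedance of $\pi$ is a value $\pi(i)$ with $i<\pi(i)$. The excedances form an increasing subsequence if, listing the values $\pi(i)$ with $\pi(i)>i$ in increasing order of the position $i$, the resulting sequence is increasing. *)

theory Defs
  imports "HOL-Combinatorics.Combinatorics" "HOL-Library.Disjoint_Sets"
begin

definition excedances :: "nat \<Rightarrow> (nat \<Rightarrow> nat) \<Rightarrow> nat list" where
  "excedances n p = map p (filter (\<lambda>i. i < p i) [1..<Suc n])"

definition bell :: "nat \<Rightarrow> nat" where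
  "bell m = card {P. partition_on {1..m} P}"

end

theory Submission
  imports Defs
begin

text \<open>Restrict a cyclic permutation of \<open>{1..n}\<close> to its arcs inside \<open>{1..m}\<close>, for growing \<open>m\<close>: this
  gives a system of disjoint directed paths covering \<open>{1..m}\<close>. Let \<open>P(m, h)\<close> be the number of such
  systems with \<open>h\<close> paths that respect the condition on excedances. When \<open>m + 1\<close> is added, it may
  or may not receive an arc; if it does, the excedance condition forces the source to be the
  smallest path end. It may also send an arc to the start of any path other than its own. Hence
  \<open>P(m + 1, h) = X h + h * X (h + 1)\<close> with \<open>X h = P(m, h - 1) + P(m, h)\<close>. The same recurrence is
  satisfied by the sum of \<open>binomial (k - 1) (h - 1)\<close> over all partitions of \<open>{1..m}\<close>, where \<open>k\<close> is the
  number of blocks. For \<open>h = 1\<close> this sum is the Bell number, and deleting \<open>n\<close> from a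
  cycle leaves a single path on \<open>{1..n - 1}\<close>.\<close>

subsection \<open>Set partitions\<close>

text \<open>The new element \<open>a\<close> either forms a block of its own, raising the block
  count by one, or joins one of the \<open>card P\<close> blocks of a partition \<open>P\<close>,
  which keeps the count.\<close>

lemma sum_partitions_insert:
  fixes f :: "nat \<Rightarrow> nat"
  assumes A: "finite A" and a: "a \<notin> A"
  shows "(\<Sum>Q | partition_on (insert a A) Q. f (card Q)) =
    (\<Sum>P | partition_on A P. f (Suc (card P)) + card P * f (card P))"
proof -
  define Ps where "Ps = {P. partition_on A P}"
  define single where "single = (\<lambda>P::'a set set. insert {a} P)"
  define join where "join = (\<lambda>(P::'a set set, B). insert (insert a B) (P - {B}))"
  have fin: "finite Ps" unfolding Ps_def by (rule finitely_many_partition_on[OF A])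
  have finP: "finite P" if "P \<in> Ps" for P
    using that finite_elements[OF A] by (auto simp: Ps_def)
  have P: "\<Union>P = A" "disjoint P" "{} \<notin> P" "\<And>B. B \<in> P \<Longrightarrow> a \<notin> B" if "P \<in> Ps" for P
    using that a by (auto simp: Ps_def partition_on_def)
  have part_single: "partition_on (insert a A) (single P)" if "P \<in> Ps" for P
  proof -
    have "insert a A - {a} = A" using a by auto
    then show ?thesis
      using that P[OF that] a by (auto simp: single_def Ps_def partition_on_insert disjnt_iff)
  qed
  have join_ss: "disjnt (insert a B) (\<Union>(P - {B}))" if "P \<in> Ps" "B \<in> P" for P B
    using P[OF that(1)] that(2) unfolding disjnt_iff disjoint_def by blast
  have part_join: "partition_on (insert a A) (join (P, B))" if "P \<in> Ps" "B \<in> P" for P B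
  proof -
    have PB: "disjnt B (\<Union>(P - {B}))"
      using join_ss[OF that] by (auto simp: disjnt_iff)
    have "partition_on A (insert B (P - {B}))"
      using that by (simp add: insert_absorb Ps_def)
    then have "partition_on (A - B) (P - {B})" "B \<subseteq> A"
      using partition_on_insert[OF PB] by auto
    moreover have "insert a A - insert a B = A - B" using a by auto
    ultimately show ?thesis
      unfolding join_def using partition_on_insert[OF join_ss[OF that]] by auto
  qed
  have range: "{Q. partition_on (insert a A) Q} = single ` Ps \<union> join ` (SIGMA P:Ps. P)"
    (is "?L = ?R")
  proof
    show "?R \<subseteq> ?L" using part_single part_join by auto
    show "?L \<subseteq> ?R"
    proof
      fix Q assume "Q \<in> ?L"
      then have Q: "partition_on (insert a A) Q" by simp
      \<comment> \<open>The block containing \<open>a\<close> tells how \<open>Q\<close> arises: by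
        \<open>single\<close> if it is \<open>{a}\<close>, otherwise by \<open>join\<close>, which
        is undone by deleting \<open>a\<close> from that block.\<close>
      then obtain B where B: "a \<in> B" "B \<in> Q" by (auto simp: partition_on_def)
      have dj: "disjnt B (\<Union>(Q - {B}))"
        using Q B unfolding partition_on_def disjoint_def disjnt_iff by blast
      have "partition_on (insert a A) (insert B (Q - {B}))"
        using Q B by (simp add: insert_absorb)
      then have part: "partition_on (insert a A - B) (Q - {B})" "B \<subseteq> insert a A"
        using partition_on_insert[OF dj] by auto
      show "Q \<in> ?R"
      proof (cases "B = {a}")
        case True
        then have "insert a A - B = A" using a by auto
        then have "Q - {B} \<in> Ps" using part by (simp add: Ps_def)
        moreover have "Q = single (Q - {B})" using B True by (auto simp: single_def)
        ultimately show ?thesis by blast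
      next
        case False
        define C where "C = B - {a}"
        have C: "C \<noteq> {}" "C \<subseteq> A" "insert a A - B = A - C"
          using False B part(2) a by (auto simp: C_def)
        have djC: "disjnt C (\<Union>(Q - {B}))" using dj by (auto simp: C_def disjnt_iff)
        have "insert C (Q - {B}) \<in> Ps"
          unfolding Ps_def using partition_on_insert[OF djC] part(1) C by simp
        moreover have "C \<notin> Q - {B}" using djC C(1) by (auto simp: disjnt_iff)
        then have "Q = join (insert C (Q - {B}), C)"
          using B by (auto simp: join_def C_def insert_absorb)
        ultimately show ?thesis by blast
      qed
    qed
  qed
  have inj_single: "inj_on single Ps"
  proof (rule inj_onI)
    fix P P' assume h: "P \<in> Ps" "P' \<in> Ps" "single P = single P'"
    then have "{a} \<notin> P" "{a} \<notin> P'" using P(4) by blast+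
    then show "P = P'" using h(3) by (simp add: single_def insert_ident)
  qed
  have inj_join: "inj_on join (SIGMA P:Ps. P)"
  proof (rule inj_onI, clarify)
    fix P B P' B' assume h: "P \<in> Ps" "B \<in> P" "P' \<in> Ps" "B' \<in> P'" "join (P, B) = join (P', B')"
    have "insert a B \<in> join (P', B')" using h(5) by (auto simp: join_def)
    \<comment> \<open>The enlarged block is the only one that contains \<open>a\<close>.\<close>
    then have "insert a B = insert a B'" using P(4)[OF h(3)] by (auto simp: join_def)
    then have BB: "B = B'" using P(4) h by (metis Diff_insert_absorb)
    have "P - {B} = join (P, B) - {insert a B}" "P' - {B} = join (P', B) - {insert a B}"
      using P(4)[OF h(1)] P(4)[OF h(3)] by (auto simp: join_def)
    then have "P - {B} = P' - {B}" using h(5) BB by simp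
    then show "P = P' \<and> B = B'" using BB h by blast
  qed
  have disj: "single ` Ps \<inter> join ` (SIGMA P:Ps. P) = {}"
  proof -
    have "{a} \<notin> join (P, B)" if "P \<in> Ps" "B \<in> P" for P B
    proof -
      have "a \<notin> B" "B \<noteq> {}" using P(3,4)[OF that(1)] that(2) by auto
      then show ?thesis using P(4)[OF that(1)] by (auto simp: join_def)
    qed
    moreover have "{a} \<in> single P" for P by (simp add: single_def)
    ultimately show ?thesis by auto
  qed
  have cs: "card (single P) = Suc (card P)" if "P \<in> Ps" for P
  proof -
    have "{a} \<notin> P" using P(4)[OF that] by blast
    then show ?thesis using finP[OF that] by (simp add: single_def)
  qed
  have cj: "card (join (P, B)) = card P" if "P \<in> Ps" "B \<in> P" for P B
  proof -
    have "insert a B \<notin> P" using P(4)[OF that(1)] by blast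
    then show ?thesis
      using finP[OF that(1)] that(2) card_gt_0_iff[of P] by (auto simp: join_def)
  qed
  have "(\<Sum>Q | partition_on (insert a A) Q. f (card Q)) =
      (\<Sum>Q\<in>single ` Ps. f (card Q)) + (\<Sum>Q\<in>join ` (SIGMA P:Ps. P). f (card Q))"
    unfolding range using fin finP disj by (intro sum.union_disjoint) auto
  also have "(\<Sum>Q\<in>single ` Ps. f (card Q)) = (\<Sum>P\<in>Ps. f (Suc (card P)))"
    using cs by (simp add: sum.reindex[OF inj_single])
  also have "(\<Sum>Q\<in>join ` (SIGMA P:Ps. P). f (card Q)) = (\<Sum>x\<in>(SIGMA P:Ps. P). f (card (fst x)))"
    using cj by (auto simp: sum.reindex[OF inj_join] intro!: sum.cong)
  \<comment> \<open>The summand does not depend on the chosen block, so each \<open>P\<close>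
    contributes it \<open>card P\<close> times.\<close>
  also have "\<dots> = (\<Sum>P\<in>Ps. card P * f (card P))"
    using fin finP sum.Sigma[of Ps "\<lambda>P. P" "\<lambda>P _. f (card P)"] by (simp add: split_beta')
  finally show ?thesis by (simp add: Ps_def sum.distrib)
qed

subsection \<open>Path systems\<close>

text \<open>An arc \<open>(x, y)\<close> records \<open>p x = y\<close>. A point without outgoing arc has its image still
  undetermined but larger than \<open>m\<close>; hence the demand that all points below the start of an ascending
  arc already have an image.\<close>

definition path_systems :: "nat \<Rightarrow> (nat \<times> nat) set set" where
  "path_systems m = {E. E \<subseteq> {1..m} \<times> {1..m} \<and> single_valued E \<and> single_valued (E\<inverse>) \<and> acyclic E \<and>
     (\<forall>(x, y)\<in>E. x < y \<longrightarrow> (\<forall>w\<in>{1..<x}. \<exists>z<y. (w, z) \<in> E))}"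

text \<open>Disjoint directed paths with \<open>card E\<close> arcs on \<open>m\<close> points have
  \<open>m - card E\<close> components, isolated points included; the equation says so without
  truncated subtraction.\<close>

definition open_paths :: "nat \<Rightarrow> nat \<Rightarrow> (nat \<times> nat) set set" where
  "open_paths m h = {E \<in> path_systems m. card E + h = m}"

lemma path_systemsD:
  assumes "E \<in> path_systems m"
  shows "E \<subseteq> {1..m} \<times> {1..m}" "finite E" "single_valued E" "single_valued (E\<inverse>)" "acyclic E"
    "\<And>x y w. (x, y) \<in> E \<Longrightarrow> x < y \<Longrightarrow> w \<in> {1..<x} \<Longrightarrow> \<exists>z<y. (w, z) \<in> E"
proof -
  show "E \<subseteq> {1..m} \<times> {1..m}" using assms by (simp add: path_systems_def)
  then show "finite E" by (rule finite_subset) simp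
qed (use assms in \<open>fastforce simp: path_systems_def\<close>)+

lemma path_systemsI:
  assumes "E \<subseteq> {1..m} \<times> {1..m}" "single_valued E" "single_valued (E\<inverse>)" "acyclic E"
    "\<And>x y w. (x, y) \<in> E \<Longrightarrow> x < y \<Longrightarrow> w \<in> {1..<x} \<Longrightarrow> \<exists>z<y. (w, z) \<in> E"
  shows "E \<in> path_systems m"
  using assms unfolding path_systems_def by blast

lemma finite_path_systems: "finite (path_systems m)"
  by (rule finite_subset[of _ "Pow ({1..m} \<times> {1..m})"]) (auto simp: path_systems_def)

lemma finite_open_paths: "finite (open_paths m h)"
  using finite_path_systems by (simp add: open_paths_def)

lemma card_Domain: "single_valued E \<Longrightarrow> card (Domain E) = card E"
  unfolding Domain_fst by (rule card_image) (auto simp: inj_on_def single_valued_def)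

lemma card_Range: "single_valued (E\<inverse>) \<Longrightarrow> card (Range E) = card E"
  using card_Domain[of "E\<inverse>"] by simp

text \<open>Each arc has its own source and its own target, so \<open>h\<close> points are left as
  ends of paths and \<open>h\<close> as starts.\<close>

lemma open_paths_card:
  assumes "E \<in> open_paths m h"
  shows "card ({1..m} - Domain E) = h" "card ({1..m} - Range E) = h"
proof -
  have E: "E \<in> path_systems m" "card E + h = m" using assms by (auto simp: open_paths_def)
  note C = path_systemsD[OF E(1)]
  have "card ({1..m} - Domain E) = card {1..m} - card (Domain E)"
    using C(1) by (intro card_Diff_subset finite_Domain C(2)) auto
  then show "card ({1..m} - Domain E) = h" using E(2) card_Domain[OF C(3)] by simp
  have "card ({1..m} - Range E) = card {1..m} - card (Range E)"
    using C(1) by (intro card_Diff_subset finite_Range C(2)) auto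
  then show "card ({1..m} - Range E) = h" using E(2) card_Range[OF C(4)] by simp
qed

text \<open>Every point lies on one path, and \<open>y\<close> is the start of that path. Existence
  walks backwards until no predecessor is left; uniqueness holds because backward walks are
  deterministic.\<close>

lemma path_systems_root:
  assumes "E \<in> path_systems m" "q \<in> {1..m}"
  shows "\<exists>!y. y \<in> {1..m} - Range E \<and> (y, q) \<in> E\<^sup>*"
proof (rule ex_ex1I)
  note C = path_systemsD[OF assms(1)]
  have "wf E" by (rule finite_acyclic_wf[OF C(2,5)])
  moreover have "q \<in> {y. (y, q) \<in> E\<^sup>*}" by simp
  ultimately obtain y where y: "(y, q) \<in> E\<^sup>*" "\<And>z. (z, y) \<in> E \<Longrightarrow> (z, q) \<notin> E\<^sup>*"
    using wfE_min[of E q "{y. (y, q) \<in> E\<^sup>*}"] by (metis mem_Collect_eq)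
  from y(1) have "y \<in> {1..m}"
    using C(1) assms(2) by (cases rule: converse_rtranclE) auto
  moreover have "y \<notin> Range E" using y by (meson RangeE converse_rtrancl_into_rtrancl)
  ultimately show "\<exists>y. y \<in> {1..m} - Range E \<and> (y, q) \<in> E\<^sup>*" using y(1) by blast
next
  note C = path_systemsD[OF assms(1)]
  fix y z assume yz: "y \<in> {1..m} - Range E \<and> (y, q) \<in> E\<^sup>*" "z \<in> {1..m} - Range E \<and> (z, q) \<in> E\<^sup>*"
  have "(y, z) \<in> (E\<inverse>)\<^sup>* \<or> (z, y) \<in> (E\<inverse>)\<^sup>*"
    by (rule single_valued_confluent[OF C(4), of q]) (use yz in \<open>auto simp: rtrancl_converse\<close>)
  then have "(z, y) \<in> E\<^sup>* \<or> (y, z) \<in> E\<^sup>*" by (simp add: rtrancl_converse)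
  then show "y = z" using yz by (metis DiffE RangeI rtranclE)
qed

section \<open>Adding one arc at the largest point\<close>

lemma single_valued_insert:
  "(a, b) \<notin> E \<Longrightarrow> single_valued (insert (a, b) E) \<longleftrightarrow> single_valued E \<and> a \<notin> Domain E"
  unfolding single_valued_def by blast

lemma single_valued_converse_insert:
  "(a, b) \<notin> E \<Longrightarrow> single_valued ((insert (a, b) E)\<inverse>) \<longleftrightarrow> single_valued (E\<inverse>) \<and> b \<notin> Range E"
  unfolding single_valued_def by blast

text \<open>The condition on ascending arcs does not refer to \<open>m\<close>, so enlarging the
  ground set merely adds an isolated point.\<close>

lemma path_systems_Suc_iff:
  "E \<in> path_systems m \<longleftrightarrow> E \<in> path_systems (Suc m) \<and> Suc m \<notin> Domain E \<and> Suc m \<notin> Range E"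
proof
  assume "E \<in> path_systems m"
  then show "E \<in> path_systems (Suc m) \<and> Suc m \<notin> Domain E \<and> Suc m \<notin> Range E"
    unfolding path_systems_def by force
next
  assume h: "E \<in> path_systems (Suc m) \<and> Suc m \<notin> Domain E \<and> Suc m \<notin> Range E"
  have "E \<subseteq> {1..m} \<times> {1..m}"
  proof clarify
    fix x y assume xy: "(x, y) \<in> E"
    then have "x \<noteq> Suc m" "y \<noteq> Suc m" using h by auto
    moreover have "(x, y) \<in> {1..Suc m} \<times> {1..Suc m}" using path_systemsD(1) h xy by blast
    ultimately show "x \<in> {1..m} \<and> y \<in> {1..m}" by auto
  qed
  then show "E \<in> path_systems m" using h by (auto simp: path_systems_def)
qed

text \<open>An arc leaving the largest point never ascends, so the excedance condition puts no
  restriction on \<open>y\<close>. The target must be the start of a path other than the one ending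
  at \<open>Suc m\<close>, since otherwise a cycle closes; reflexivity of \<open>E\<^sup>*\<close>
  also excludes a loop.\<close>

lemma path_systems_insert_top_iff:
  assumes "(Suc m, y) \<notin> E"
  shows "insert (Suc m, y) E \<in> path_systems (Suc m) \<longleftrightarrow>
    E \<in> path_systems (Suc m) \<and> Suc m \<notin> Domain E \<and> y \<in> {1..Suc m} - Range E \<and> (y, Suc m) \<notin> E\<^sup>*"
    (is "?L \<longleftrightarrow> ?R")
proof
  assume L: ?L
  note C = path_systemsD[OF L]
  have y: "y \<le> Suc m" "1 \<le> y" using C(1) by auto
  have 1: "Suc m \<notin> Domain E" "y \<notin> Range E"
    and sv: "single_valued E" "single_valued (E\<inverse>)"
    using C(3,4) single_valued_insert[OF assms(1)] single_valued_converse_insert[OF assms(1)] by auto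
  have "\<exists>z<b. (w, z) \<in> E" if ab: "(a, b) \<in> E" "a < b" "w \<in> {1..<a}" for a b w
  proof -
    obtain z where z: "z < b" "(w, z) \<in> insert (Suc m, y) E" using C(6)[of a b w] ab by (metis insertI2)
    \<comment> \<open>The witness leaves from \<open>w\<close>, which lies below \<open>a\<close>
      and hence below \<open>Suc m\<close>; so it is not the new arc.\<close>
    moreover have "w \<noteq> Suc m" using ab C(1) by fastforce
    ultimately show ?thesis by auto
  qed
  then have "E \<in> path_systems (Suc m)"
    using C(1,5) sv by (intro path_systemsI) auto
  then show ?R using 1 y C(5) by auto
next
  assume R: ?R
  then have E: "E \<in> path_systems (Suc m)" by simp
  note C = path_systemsD[OF E]
  have "single_valued (insert (Suc m, y) E)" "single_valued ((insert (Suc m, y) E)\<inverse>)"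
    using C(3,4) R single_valued_insert[OF assms(1)] single_valued_converse_insert[OF assms(1)] by auto
  moreover have "acyclic (insert (Suc m, y) E)" using R C(5) by simp
  moreover have "insert (Suc m, y) E \<subseteq> {1..Suc m} \<times> {1..Suc m}" using C(1) R by auto
  moreover have "\<exists>z<b. (w, z) \<in> insert (Suc m, y) E"
    if ab: "(a, b) \<in> insert (Suc m, y) E" "a < b" "w \<in> {1..<a}" for a b w
  proof -
    have "(a, b) \<in> E" using ab R by auto
    then show ?thesis using C(6)[of a b w] ab by auto
  qed
  ultimately show ?L by (intro path_systemsI)
qed

text \<open>The arc into the new largest point must leave from the smallest point without outgoing
  arc; this is the whole effect of the nonnesting condition.\<close>

lemma path_systems_insert_into_top_iff:
  assumes "(q, Suc m) \<notin> E" "Suc m \<notin> Domain E" "q \<noteq> Suc m"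
  shows "insert (q, Suc m) E \<in> path_systems (Suc m) \<longleftrightarrow>
    E \<in> path_systems m \<and> q \<in> {1..m} - Domain E \<and> {1..<q} \<subseteq> Domain E"
    (is "?L \<longleftrightarrow> ?R")
proof
  assume L: ?L
  note C = path_systemsD[OF L]
  have q: "q \<in> {1..m}" using C(1) assms(3) by auto
  have 1: "q \<notin> Domain E" "Suc m \<notin> Range E"
    and sv: "single_valued E" "single_valued (E\<inverse>)"
    using C(3,4) single_valued_insert[OF assms(1)] single_valued_converse_insert[OF assms(1)] by auto
  have "\<exists>z<b. (w, z) \<in> E" if ab: "(a, b) \<in> E" "a < b" "w \<in> {1..<a}" for a b w
  proof -
    obtain z where z: "z < b" "(w, z) \<in> insert (q, Suc m) E" using C(6)[of a b w] ab by (metis insertI2)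
    \<comment> \<open>The target \<open>z\<close> lies below \<open>b\<close>, hence below
      \<open>Suc m\<close>, so the arc found is not the new one.\<close>
    moreover have "b \<le> Suc m" using ab C(1) by fastforce
    ultimately show ?thesis by auto
  qed
  then have "E \<in> path_systems (Suc m)"
    using C(1,5) sv by (intro path_systemsI) auto
  then have "E \<in> path_systems m" using path_systems_Suc_iff[of E m] 1 assms by blast
  moreover have "w \<in> Domain E" if "w \<in> {1..<q}" for w
    using C(6)[of q "Suc m" w] that q by auto
  ultimately show ?R using q 1 by auto
next
  assume R: ?R
  then have E: "E \<in> path_systems m" by simp
  note C = path_systemsD[OF E]
  have "single_valued (insert (q, Suc m) E)"
    using C(3) R single_valued_insert[OF assms(1)] single_valued_converse_insert[OF assms(1)] by auto
  moreover have "single_valued ((insert (q, Suc m) E)\<inverse>)"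
    using C(1,4) single_valued_insert[OF assms(1)] single_valued_converse_insert[OF assms(1)] by force
  \<comment> \<open>\<open>Suc m\<close> has no outgoing arc and differs from \<open>q\<close>, so
    the new arc cannot close a cycle.\<close>
  moreover have "(Suc m, q) \<notin> E\<^sup>*"
    using assms by (auto elim: converse_rtranclE)
  then have "acyclic (insert (q, Suc m) E)" using C(5) by simp
  moreover have "insert (q, Suc m) E \<subseteq> {1..Suc m} \<times> {1..Suc m}" using C(1) R by fastforce
  moreover have "\<exists>z<b. (w, z) \<in> insert (q, Suc m) E"
    if ab: "(a, b) \<in> insert (q, Suc m) E" "a < b" "w \<in> {1..<a}" for a b w
  proof (cases "(a, b) \<in> E")
    case True
    then show ?thesis using C(6)[of a b w] ab by auto
  next
    case False
    then have "w \<in> Domain E" "b = Suc m" using ab R by auto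
    then obtain z where "(w, z) \<in> E" by auto
    moreover then have "z < Suc m" using C(1) by auto
    ultimately show ?thesis using \<open>b = Suc m\<close> by auto
  qed
  ultimately show ?L by (intro path_systemsI)
qed

section \<open>Recurrence for the number of path systems\<close>

text \<open>Without an incoming arc, \<open>Suc m\<close> is a path of its own, added to
  \<open>h\<close> others. With one, it prolongs, among \<open>Suc h\<close> paths, the path with
  the smallest end; the source being forced, no factor appears.\<close>

lemma card_open_paths_sink:
  "card {E \<in> open_paths (Suc m) (Suc h). Suc m \<notin> Domain E} =
    card (open_paths m h) + card (open_paths m (Suc h))"
proof -
  define q where "q = (\<lambda>E::(nat \<times> nat) set. Min ({1..m} - Domain E))"
  define ext where "ext = (\<lambda>E::(nat \<times> nat) set. insert (q E, Suc m) E)"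
  have q: "q E \<in> {1..m} - Domain E" "{1..<q E} \<subseteq> Domain E" if "E \<in> open_paths m (Suc h)" for E
  proof -
    have ne: "{1..m} - Domain E \<noteq> {}"
      using open_paths_card(1)[OF that] by (metis card.empty nat.distinct(1))
    show *: "q E \<in> {1..m} - Domain E" unfolding q_def by (rule Min_in) (use ne in auto)
    show "{1..<q E} \<subseteq> Domain E"
    proof
      fix w assume w: "w \<in> {1..<q E}"
      show "w \<in> Domain E"
      proof (rule ccontr)
        assume "w \<notin> Domain E"
        then have "q E \<le> w" unfolding q_def using w * by (intro Min_le) auto
        then show False using w by simp
      qed
    qed
  qed
  have q_unique: "x = q E" if "x \<in> {1..m} - Domain E" "{1..<x} \<subseteq> Domain E" for x E
  proof -
    have "x \<le> y" if "y \<in> {1..m} - Domain E" for y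
    proof (rule ccontr)
      assume "\<not> x \<le> y"
      then have "y \<in> {1..<x}" using that by auto
      then show False using that \<open>{1..<x} \<subseteq> Domain E\<close> by blast
    qed
    then show ?thesis
      unfolding q_def using \<open>x \<in> _\<close> by (intro Min_eqI[symmetric]) simp_all
  qed
  have top: "Suc m \<notin> Domain E" "Suc m \<notin> Range E" "finite E" if "E \<in> open_paths m k" for E k
    using that path_systems_Suc_iff[of E m] path_systemsD(2)[of E m] unfolding open_paths_def by blast+
  have inj: "inj_on ext (open_paths m (Suc h))"
  proof (rule inj_onI)
    fix E F assume EF: "E \<in> open_paths m (Suc h)" "F \<in> open_paths m (Suc h)" "ext E = ext F"
    \<comment> \<open>No arc of \<open>E\<close> enters \<open>Suc m\<close>, so discarding such
      arcs from \<open>ext E\<close> recovers \<open>E\<close>.\<close>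
    have "E = {a \<in> ext E. snd a \<noteq> Suc m}" using top(2)[OF EF(1)] by (auto simp: ext_def)
    moreover have "F = {a \<in> ext F. snd a \<noteq> Suc m}" using top(2)[OF EF(2)] by (auto simp: ext_def)
    ultimately show "E = F" using EF(3) by simp
  qed
  have "{E \<in> open_paths (Suc m) (Suc h). Suc m \<notin> Domain E} =
      open_paths m h \<union> ext ` open_paths m (Suc h)" (is "?L = ?R")
  proof
    show "?R \<subseteq> ?L"
    proof
      fix E assume "E \<in> ?R"
      then consider "E \<in> open_paths m h" | F where "F \<in> open_paths m (Suc h)" "E = ext F" by auto
      then show "E \<in> ?L"
      proof cases
        case 1
        then show ?thesis using path_systems_Suc_iff[of E m] by (auto simp: open_paths_def)
      next
        case 2
        note t = top[OF 2(1)]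
        have "F \<in> path_systems m" "card F + Suc h = m" using 2 by (auto simp: open_paths_def)
        moreover have "(q F, Suc m) \<notin> F" "q F \<noteq> Suc m" using t q(1)[OF 2(1)] by auto
        ultimately have "E \<in> path_systems (Suc m)" "card E = Suc (card F)"
          using 2 q[OF 2(1)] t path_systems_insert_into_top_iff[of "q F" m F] by (auto simp: ext_def)
        moreover have "Suc m \<notin> Domain E" using t q(1)[OF 2(1)] 2(2) by (auto simp: ext_def)
        ultimately show ?thesis using \<open>card F + Suc h = m\<close> by (simp add: open_paths_def)
      qed
    qed
    show "?L \<subseteq> ?R"
    proof
      fix E assume E: "E \<in> ?L"
      then have Ec: "E \<in> path_systems (Suc m)" and cE: "card E + Suc h = Suc m" "Suc m \<notin> Domain E"
        by (auto simp: open_paths_def)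
      note C = path_systemsD[OF Ec]
      show "E \<in> ?R"
      proof (cases "Suc m \<in> Range E")
        case False
        then have "E \<in> open_paths m h" using cE Ec path_systems_Suc_iff[of E m] by (auto simp: open_paths_def)
        then show ?thesis by simp
      next
        case True
        then obtain x where x: "(x, Suc m) \<in> E" by auto
        define F where "F = E - {(x, Suc m)}"
        have EF: "E = insert (x, Suc m) F" and nF: "(x, Suc m) \<notin> F" using x by (auto simp: F_def)
        have d: "Suc m \<notin> Domain F" "x \<noteq> Suc m" using cE x by (auto simp: F_def)
        have F: "F \<in> path_systems m" "x \<in> {1..m} - Domain F" "{1..<x} \<subseteq> Domain F"
          using path_systems_insert_into_top_iff[OF nF d] Ec EF by auto
        have "card E = Suc (card F)" using C(2) EF nF by auto
        then have "F \<in> open_paths m (Suc h)" using F cE by (simp add: open_paths_def)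
        moreover have "E = ext F" using q_unique[OF F(2,3)] EF by (simp add: ext_def)
        ultimately show ?thesis by blast
      qed
    qed
  qed
  moreover have "open_paths m h \<inter> ext ` open_paths m (Suc h) = {}"
    using top(2) by (fastforce simp: ext_def)
  ultimately show ?thesis
    by (simp add: card_Un_disjoint finite_open_paths card_image[OF inj])
qed

text \<open>Removing the arc out of \<open>Suc m\<close>, if present, splits one path into two and
  leaves \<open>Suc h\<close>. Conversely, \<open>Suc m\<close> may send an arc to the start of any
  of the \<open>h\<close> paths not containing it.\<close>

lemma card_open_paths_Suc:
  "card (open_paths (Suc m) h) = card {E \<in> open_paths (Suc m) h. Suc m \<notin> Domain E} +
    h * card {E \<in> open_paths (Suc m) (Suc h). Suc m \<notin> Domain E}"
proof -
  define X where "X = {E \<in> open_paths (Suc m) (Suc h). Suc m \<notin> Domain E}"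
  define R where "R = (\<lambda>E. {y \<in> {1..Suc m} - Range E. (y, Suc m) \<notin> E\<^sup>*})"
  define ext where "ext = (\<lambda>(E, y::nat). insert (Suc m, y) E)"
  have finX: "finite X" by (simp add: X_def finite_open_paths)
  have cR: "card (R E) = h" if "E \<in> X" for E
  proof -
    have E: "E \<in> open_paths (Suc m) (Suc h)" using that by (simp add: X_def)
    then obtain r where r: "r \<in> {1..Suc m} - Range E" "(r, Suc m) \<in> E\<^sup>*"
      and un: "\<And>y. y \<in> {1..Suc m} - Range E \<Longrightarrow> (y, Suc m) \<in> E\<^sup>* \<Longrightarrow> y = r"
      using path_systems_root[of E "Suc m" "Suc m"] by (auto simp: open_paths_def)
    \<comment> \<open>Of the \<open>Suc h\<close> path starts exactly one, \<open>r\<close>, leads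
      to \<open>Suc m\<close>.\<close>
    have "R E = ({1..Suc m} - Range E) - {r}" using r un unfolding R_def by blast
    then show ?thesis using r(1) open_paths_card(2)[OF E] by simp
  qed
  have "{E \<in> open_paths (Suc m) h. Suc m \<in> Domain E} = ext ` (SIGMA E:X. R E)" (is "?L = ?R")
  proof
    show "?R \<subseteq> ?L"
    proof clarify
      fix F y assume Fy: "F \<in> X" "y \<in> R F"
      then have F: "F \<in> path_systems (Suc m)" "card F + Suc h = Suc m" "Suc m \<notin> Domain F" "finite F"
        using path_systemsD(2) by (auto simp: X_def open_paths_def)
      then have "(Suc m, y) \<notin> F" by auto
      then show "ext (F, y) \<in> open_paths (Suc m) h \<and> Suc m \<in> Domain (ext (F, y))"
        using path_systems_insert_top_iff[of m y F] F Fy(2) by (auto simp: ext_def R_def open_paths_def)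
    qed
    show "?L \<subseteq> ?R"
    proof
      fix E assume "E \<in> ?L"
      then have E: "E \<in> path_systems (Suc m)" "card E + h = Suc m" "finite E" and "Suc m \<in> Domain E"
        using path_systemsD(2) by (auto simp: open_paths_def)
      then obtain y where y: "(Suc m, y) \<in> E" by auto
      define F where "F = E - {(Suc m, y)}"
      have EF: "E = insert (Suc m, y) F" and nF: "(Suc m, y) \<notin> F" using y by (auto simp: F_def)
      have "card E = Suc (card F)" using E(3) EF nF by auto
      then have "F \<in> X" "y \<in> R F"
        using path_systems_insert_top_iff[OF nF] E EF by (auto simp: X_def R_def open_paths_def)
      then show "E \<in> ?R" using EF by (force simp: ext_def)
    qed
  qed
  moreover have "inj_on ext (SIGMA E:X. R E)"
  proof (rule inj_onI, clarify)
    fix E y F z assume h: "E \<in> X" "F \<in> X" "ext (E, y) = ext (F, z)"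
    have d: "Suc m \<notin> Domain E" "Suc m \<notin> Domain F" using h by (auto simp: X_def)
    have "E = {a \<in> ext (E, y). fst a \<noteq> Suc m}" "F = {a \<in> ext (F, z). fst a \<noteq> Suc m}"
      using d by (force simp: ext_def)+
    then have "E = F" using h(3) by simp
    moreover have "(Suc m, y) \<in> ext (F, z)" using h(3) by (auto simp: ext_def)
    then have "y = z" using d by (auto simp: ext_def)
    ultimately show "E = F \<and> y = z" by simp
  qed
  ultimately have "card {E \<in> open_paths (Suc m) h. Suc m \<in> Domain E} = card (SIGMA E:X. R E)"
    by (simp add: card_image)
  also have "\<dots> = (\<Sum>E\<in>X. card (R E))"
    using finX by (intro card_SigmaI) (auto simp: R_def)
  also have "\<dots> = h * card X" using cR by simp
  finally have "card {E \<in> open_paths (Suc m) h. Suc m \<in> Domain E} = h * card X" .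
  moreover have "open_paths (Suc m) h =
    {E \<in> open_paths (Suc m) h. Suc m \<notin> Domain E} \<union> {E \<in> open_paths (Suc m) h. Suc m \<in> Domain E}"
    by auto
  then have "card (open_paths (Suc m) h) = card {E \<in> open_paths (Suc m) h. Suc m \<notin> Domain E} +
      card {E \<in> open_paths (Suc m) h. Suc m \<in> Domain E}"
    by (metis (no_types, lifting) card_Un_disjoint disjoint_iff finite_Un finite_open_paths mem_Collect_eq)
  ultimately show ?thesis by (simp add: X_def)
qed

lemma open_paths_Suc_0: "open_paths (Suc m) 0 = {}"
proof (rule ccontr)
  assume "open_paths (Suc m) 0 \<noteq> {}"
  then obtain E where E: "E \<in> open_paths (Suc m) 0" by auto
  then obtain y where "y \<in> {1..Suc m} - Range E"
    using path_systems_root[of E "Suc m" 1] by (auto simp: open_paths_def)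
  then show False using open_paths_card(2)[OF E] by auto
qed

lemma open_paths_0: "open_paths 0 h = (if h = 0 then {{}} else {})"
  by (auto simp: open_paths_def path_systems_def single_valued_def acyclic_def)

lemma card_open_paths_recurrence:
  "card (open_paths (Suc m) (Suc h)) = card (open_paths m h) + card (open_paths m (Suc h)) +
    Suc h * (card (open_paths m (Suc h)) + card (open_paths m (Suc (Suc h))))"
  by (simp only: card_open_paths_Suc[of m "Suc h"] card_open_paths_sink)

section \<open>Solving the recurrence by sums over set partitions\<close>

text \<open>Split \<open>j\<close> as \<open>h + (j - h)\<close> and absorb the second factor into
  the next binomial coefficient. This trades a factor depending on the number of blocks for factors
  depending on \<open>h\<close> only.\<close>

lemma mult_binomial_same: "j * (j choose h) = h * (j choose h) + Suc h * (j choose Suc h)"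
proof (cases "h \<le> j")
  case True
  have "Suc h * (j choose Suc h) = (j - h) * (j choose h)"
    by (metis binomial_absorb_comp binomial_absorption mult.commute)
  then show ?thesis using True by (simp add: add_mult_distrib[symmetric])
qed (simp add: binomial_eq_0)

text \<open>Both sides satisfy the same recurrence. For a partition with \<open>j + 1\<close>
  blocks, inserting an element yields \<open>(Suc j choose h) + Suc j * (j choose h)\<close>, which
  Pascal's rule and \<open>mult_binomial_same\<close> turn into the terms of the path
  recurrence.\<close>

lemma card_open_paths:
  "card (open_paths (Suc m) (Suc h)) = (\<Sum>P | partition_on {1..Suc m} P. (card P - 1) choose h)"
proof (induction m arbitrary: h)
  case 0
  have "(\<Sum>P | partition_on (insert (Suc 0) {}) P. (card P - 1) choose h) = 0 choose h"
  proof -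
    have "Collect (partition_on {}) = {{} :: nat set set}" by (auto simp: partition_on_empty)
    then show ?thesis
      by (subst sum_partitions_insert[where f = "\<lambda>k. (k - 1) choose h"]) auto
  qed
  moreover have "{1..Suc 0} = insert (Suc 0) {}" by auto
  ultimately show ?case by (simp add: card_open_paths_recurrence open_paths_0)
next
  case (Suc m)
  let ?S = "\<lambda>f. \<Sum>P | partition_on {1..Suc m} P. f (card P - 1)"
  \<comment> \<open>The ground set is nonempty, so there is a block and subtracting one from
    \<open>card P\<close> is not truncated.\<close>
  have "card P \<ge> 1" if P: "partition_on {1..Suc m} P" for P
  proof -
    have "P \<noteq> {}" using P by (auto simp: partition_on_def)
    moreover have "finite P" using P by (rule finite_elements[rotated]) simp
    ultimately show ?thesis by (simp add: Suc_leI card_gt_0_iff)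
  qed
  then have pos: "card P = Suc (card P - 1)" if "partition_on {1..Suc m} P" for P
    using that by fastforce
  have ins: "{1..Suc (Suc m)} = insert (Suc (Suc m)) {1..Suc m}" by auto
  have "(\<Sum>P | partition_on {1..Suc (Suc m)} P. (card P - 1) choose h) =
    (\<Sum>P | partition_on {1..Suc m} P. (card P choose h) + card P * ((card P - 1) choose h))"
    unfolding ins by (subst sum_partitions_insert[where f = "\<lambda>k. (k - 1) choose h"]) auto
  also have "\<dots> = ?S (\<lambda>j. (Suc j choose h) + Suc j * (j choose h))"
    by (intro sum.cong refl) (metis mem_Collect_eq pos)
  finally have *: "(\<Sum>P | partition_on {1..Suc (Suc m)} P. (card P - 1) choose h) =
    ?S (\<lambda>j. (Suc j choose h) + Suc j * (j choose h))" .
  show ?case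
  proof (cases h)
    case 0
    \<comment> \<open>Here the recurrence refers to systems with no path, of which there are none;
      the weight is \<open>j + 2\<close>.\<close>
    have "?S (\<lambda>j. (Suc j choose h) + Suc j * (j choose h)) =
        ?S (\<lambda>j. 2 * (j choose 0) + (j choose 1))"
      using 0 by (intro sum.cong) auto
    also have "\<dots> = 2 * ?S (\<lambda>j. j choose 0) + ?S (\<lambda>j. j choose 1)"
      by (simp only: sum.distrib flip: sum_distrib_left)
    finally show ?thesis
      unfolding * using 0 by (simp add: card_open_paths_recurrence[of "Suc m"] open_paths_Suc_0 Suc.IH)
  next
    case (Suc g)
    have "?S (\<lambda>j. (Suc j choose h) + Suc j * (j choose h)) =
        ?S (\<lambda>j. (j choose g) + (j choose h) + Suc h * ((j choose h) + (j choose Suc h)))"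
      using Suc by (intro sum.cong) (auto simp: mult_binomial_same[of _ "Suc g"] algebra_simps)
    also have "\<dots> = ?S (\<lambda>j. j choose g) + ?S (\<lambda>j. j choose h) +
        Suc h * (?S (\<lambda>j. j choose h) + ?S (\<lambda>j. j choose Suc h))"
      by (simp only: sum.distrib flip: sum_distrib_left)
    finally show ?thesis
      unfolding * card_open_paths_recurrence[of "Suc m"] Suc.IH using Suc Suc.IH[of g] by simp
  qed
qed

text \<open>For one path every binomial coefficient has lower index 0, so the sum counts partitions.
  For \<open>m = 0\<close> there is no path at all, although \<open>bell 0\<close> is 1.\<close>

lemma card_open_paths_1: "card (open_paths m 1) = (if m = 0 then 0 else bell m)"
  by (cases m) (auto simp: open_paths_0 card_open_paths[of _ 0, simplified] bell_def)

subsection \<open>Cyclic permutations as single paths\<close>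

lemma sorted_wrt_less_map_iff:
  fixes p :: "nat \<Rightarrow> nat"
  assumes "sorted_wrt (<) xs"
  shows "sorted_wrt (<) (map p xs) \<longleftrightarrow> (\<forall>x\<in>set xs. \<forall>y\<in>set xs. x < y \<longrightarrow> p x < p y)"
  using assms by (induction xs) (auto dest: less_asym)

lemma sorted_excedances_iff:
  "sorted_wrt (<) (excedances n p) \<longleftrightarrow>
    (\<forall>x\<in>{1..n}. \<forall>y\<in>{1..n}. x < y \<longrightarrow> x < p x \<longrightarrow> y < p y \<longrightarrow> p x < p y)"
proof -
  have "sorted_wrt (<) (filter (\<lambda>i. i < p i) [1..<Suc n])"
    by (intro sorted_wrt_filter sorted_wrt_upt)
  from sorted_wrt_less_map_iff[OF this, of p] show ?thesis
    by (auto simp: excedances_def simp del: upt_Suc)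
qed

text \<open>This is \<open>p\<close> with the point \<open>Suc m\<close> deleted: both the arc
  leaving it and the arc entering it are dropped, which opens a cycle into a path on
  \<open>{1..m}\<close>.\<close>

definition arcs :: "nat \<Rightarrow> (nat \<Rightarrow> nat) \<Rightarrow> (nat \<times> nat) set" where
  "arcs m p = {(x, p x) |x. x \<in> {1..m} \<and> p x \<noteq> Suc m}"

lemma single_valued_arcs: "single_valued (arcs m p)"
  by (auto simp: single_valued_def arcs_def)

lemma single_valued_converse_arcs: "inj p \<Longrightarrow> single_valued ((arcs m p)\<inverse>)"
  by (auto simp: single_valued_def arcs_def dest: injD)

lemma arcs_subset:
  assumes "p permutes {1..Suc m}"
  shows "arcs m p \<subseteq> {1..m} \<times> {1..m}"
proof -
  have "p x \<in> {1..m}" if "x \<in> {1..m}" "p x \<noteq> Suc m" for x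
    using permutes_in_image[OF assms, of x] that by auto
  then show ?thesis by (auto simp: arcs_def)
qed

text \<open>A cycle among the arcs would be an orbit of \<open>p\<close> avoiding
  \<open>Suc m\<close>, whereas the orbit of each point of \<open>{1..Suc m}\<close> is the whole
  set.\<close>

lemma acyclic_arcs:
  assumes p: "p permutes {1..Suc m}" and c: "cyclic_on p {1..Suc m}"
  shows "acyclic (arcs m p)"
  unfolding acyclic_def
proof clarify
  fix x assume x: "(x, x) \<in> (arcs m p)\<^sup>+"
  let ?E = "arcs m p"
  have "y \<in> {1..m} \<and> (y, x) \<in> ?E\<^sup>+" if "y \<in> orbit p x" for y
  proof -
    have step: "p y \<in> {1..m} \<and> (p y, x) \<in> ?E\<^sup>+" if "(y, x) \<in> ?E\<^sup>+" for y
    proof -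
      obtain z where z: "(y, z) \<in> ?E" "(z, x) \<in> ?E\<^sup>*" using tranclD[OF \<open>(y, x) \<in> ?E\<^sup>+\<close>] by auto
      then have "z = p y" "z \<in> {1..m}" using arcs_subset[OF p] by (auto simp: arcs_def)
      then show ?thesis using z(2) x by (auto intro: rtrancl_trancl_trancl)
    qed
    show ?thesis using that by induct (use step x in blast)+
  qed
  moreover have "x \<in> {1..Suc m}"
    using tranclD[OF x] arcs_subset[OF p] by force
  then have "orbit p x = {1..Suc m}" using c by (auto simp: cyclic_on_alldef)
  then have "Suc m \<in> orbit p x" by simp
  ultimately show False by force
qed

lemma arcs_nonnesting_iff:
  assumes p: "p permutes {1..Suc m}"
  shows "sorted_wrt (<) (excedances (Suc m) p) \<longleftrightarrow>
    (\<forall>(x, y)\<in>arcs m p. x < y \<longrightarrow> (\<forall>w\<in>{1..<x}. \<exists>z<y. (w, z) \<in> arcs m p))"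
    (is "?L \<longleftrightarrow> ?R")
proof
  assume ?L
  then have L: "\<And>x y. x \<in> {1..Suc m} \<Longrightarrow> y \<in> {1..Suc m} \<Longrightarrow> x < y \<Longrightarrow> x < p x \<Longrightarrow> y < p y \<Longrightarrow> p x < p y"
    unfolding sorted_excedances_iff by blast
  have "\<exists>z<y. (w, z) \<in> arcs m p" if h: "(x, y) \<in> arcs m p" "x < y" "w \<in> {1..<x}" for x y w
  proof -
    have xy: "x \<in> {1..m}" "y = p x" "y \<in> {1..m}"
      using h(1) arcs_subset[OF p] by (auto simp: arcs_def)
    \<comment> \<open>If \<open>w\<close> carries an excedance, the ordering applies; otherwise
      \<open>p w \<le> w < x < y\<close>.\<close>
    have "p w < y"
    proof (cases "w < p w")
      case True
      then show ?thesis using L[of w x] xy h by auto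
    qed (use h in auto)
    then show ?thesis using xy h(3) by (auto simp: arcs_def)
  qed
  then show ?R by blast
next
  assume R: ?R
  have "p x < p y" if h: "x \<in> {1..Suc m}" "y \<in> {1..Suc m}" "x < y" "x < p x" "y < p y" for x y
  proof (cases "p y = Suc m")
    \<comment> \<open>The arc into \<open>Suc m\<close> is not recorded in \<open>arcs\<close>, but
      its target exceeds all other values on the set.\<close>
    case True
    have "p x \<noteq> p y" using permutes_inj[OF p] h(3) by (auto dest: injD)
    moreover have "p x \<le> Suc m" using permutes_in_image[OF p, of x] h(1) by auto
    ultimately show ?thesis using True by simp
  next
    case False
    have "p y \<le> Suc m" using permutes_in_image[OF p, of y] h(2) by auto
    then have "(y, p y) \<in> arcs m p" using False h by (auto simp: arcs_def)
    moreover have "x \<in> {1..<y}" using h by auto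
    ultimately obtain z where "z < p y" "(x, z) \<in> arcs m p" using R h(5) by blast
    then show ?thesis by (auto simp: arcs_def)
  qed
  then show ?L unfolding sorted_excedances_iff by blast
qed

text \<open>The only point of \<open>{1..m}\<close> without an arc is the preimage of
  \<open>Suc m\<close>, which is not \<open>Suc m\<close> itself by the second assumption.\<close>

lemma card_arcs:
  assumes p: "p permutes {1..Suc m}" and "p (Suc m) \<noteq> Suc m"
  shows "card (arcs m p) + 1 = m"
proof -
  obtain q where q: "p q = Suc m" "q \<in> {1..Suc m}"
    using permutes_image[OF p] by (metis Suc_le_mono atLeastAtMost_iff imageE le0 One_nat_def order_refl)
  then have q': "q \<in> {1..m}" using assms(2) by (cases "q = Suc m") auto
  have "p x = Suc m \<longleftrightarrow> x = q" for x using q(1) permutes_inj[OF p] by (metis injD)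
  then have "arcs m p = (\<lambda>x. (x, p x)) ` ({1..m} - {q})" by (auto simp: arcs_def)
  then have "card (arcs m p) = card ({1..m} - {q})"
    by (simp add: card_image inj_on_def)
  then show ?thesis using q' by auto
qed

text \<open>A point of \<open>{1..m}\<close> without an arc can only be sent to
  \<open>Suc m\<close>, so the arcs fix \<open>p\<close> off \<open>Suc m\<close>; bijectivity then
  forces the remaining value.\<close>

lemma arcs_inject:
  assumes p: "p permutes {1..Suc m}" and p': "p' permutes {1..Suc m}" and eq: "arcs m p = arcs m p'"
  shows "p = p'"
proof -
  have eq_off: "p x = p' x" if "x \<noteq> Suc m" for x
  proof (cases "x \<in> {1..m}")
    case True
    then show ?thesis
      using eq by (cases "p x = Suc m"; cases "p' x = Suc m") (auto simp: arcs_def set_eq_iff)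
  next
    case False
    then have "x \<notin> {1..Suc m}" using that by auto
    then show ?thesis using permutes_not_in[OF p] permutes_not_in[OF p'] by simp
  qed
  moreover have "p (Suc m) = p' (Suc m)"
  proof -
    obtain w where w: "p' w = p (Suc m)" using permutes_surj[OF p'] by (metis surjD)
    then have "w = Suc m" using eq_off[of w] permutes_inj[OF p] by (metis injD)
    then show ?thesis using w by simp
  qed
  ultimately show ?thesis by (metis ext)
qed

text \<open>The unique path, from \<open>r\<close> to \<open>q\<close>, is closed to a cycle through
  the new point: \<open>q\<close> goes to \<open>Suc m\<close> and \<open>Suc m\<close> goes to
  \<open>r\<close>.\<close>

lemma arcs_surj:
  assumes E: "E \<in> open_paths m 1"
  obtains p where "p permutes {1..Suc m}" "cyclic_on p {1..Suc m}" "arcs m p = E"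
proof -
  have Ep: "E \<in> path_systems m" using E by (simp add: open_paths_def)
  note C = path_systemsD[OF Ep]
  obtain q where q: "{1..m} - Domain E = {q}"
    using open_paths_card(1)[OF E] by (auto simp: card_1_singleton_iff)
  obtain r where r: "{1..m} - Range E = {r}"
    using open_paths_card(2)[OF E] by (auto simp: card_1_singleton_iff)
  define p where "p x = (if x = Suc m then r else if x = q then Suc m
    else if x \<in> Domain E then THE y. (x, y) \<in> E else x)" for x
  have qE: "q \<in> {1..m}" "q \<notin> Domain E" and rE: "r \<in> {1..m}" "r \<notin> Range E" using q r by auto
  have dom: "Domain E = {1..m} - {q}" using q C(1) by auto
  have ran: "Range E = {1..m} - {r}" using r C(1) by auto
  have top: "p (Suc m) = r" "p q = Suc m" using qE by (auto simp: p_def)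
  have pE: "p x = y" if "(x, y) \<in> E" for x y
  proof -
    have "(THE y. (x, y) \<in> E) = y" using that C(3) by (auto simp: single_valued_def)
    moreover have "x \<noteq> Suc m" "x \<noteq> q" "x \<in> Domain E" using that C(1) qE by auto
    ultimately show ?thesis by (simp add: p_def)
  qed
  have in_E: "(x, p x) \<in> E" if "x \<in> {1..m}" "x \<noteq> q" for x
  proof -
    from that dom obtain y where "(x, y) \<in> E" by blast
    then show ?thesis using pE by auto
  qed
  have "p ` {1..Suc m} = {1..Suc m}"
  proof
    have "p x \<in> {1..Suc m}" if x: "x \<in> {1..Suc m}" for x
    proof -
      consider "x = Suc m" | "x = q" | "x \<in> {1..m}" "x \<noteq> q"
        using x by (metis atLeastAtMost_iff le_SucE)
      then show ?thesis
      proof cases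
        case 3
        then show ?thesis using in_E[OF 3] C(1) by fastforce
      qed (use top rE in auto)
    qed
    then show "p ` {1..Suc m} \<subseteq> {1..Suc m}" by blast
    show "{1..Suc m} \<subseteq> p ` {1..Suc m}"
    proof
      fix y assume y: "y \<in> {1..Suc m}"
      consider "y = Suc m" | "y = r" | "y \<in> Range E"
        using y ran by (metis DiffI atLeastAtMost_iff le_SucE singletonD)
      then show "y \<in> p ` {1..Suc m}"
      proof cases
        case 1
        then show ?thesis using top(2) qE by force
      next
        case 2
        then show ?thesis using top(1) by force
      next
        case 3
        then obtain x where "(x, y) \<in> E" by auto
        then have "p x = y" "x \<in> {1..Suc m}" using pE C(1) by force+
        then show ?thesis by blast
      qed
    qed
  qed
  moreover from this have "inj_on p {1..Suc m}" by (intro eq_card_imp_inj_on) auto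
  moreover have "p x = x" if "x \<notin> {1..Suc m}" for x
    using that dom qE by (auto simp: p_def)
  ultimately have p: "p permutes {1..Suc m}" by (intro bij_imp_permutes) (auto simp: bij_betw_def)
  \<comment> \<open>Walking forward along the arcs ends at \<open>q\<close>, the only point of
    \<open>{1..m}\<close> without one, and \<open>q\<close> is sent to \<open>Suc m\<close>.\<close>
  have reach: "x \<in> {1..m} \<Longrightarrow> Suc m \<in> orbit p x" for x
  proof (induction x rule: wf_induct_rule[OF finite_acyclic_wf_converse[OF C(2,5)]])
    case (1 x)
    show ?case
    proof (cases "x = q")
      case True
      then show ?thesis using orbit.base[of p x] top by simp
    next
      case False
      then have "(x, p x) \<in> E" using in_E 1 by simp
      then have "Suc m \<in> orbit p (p x)" using 1 C(1) by blast
      then show ?thesis by (rule orbit_subset)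
    qed
  qed
  have perm: "permutation p" using p by (rule permutes_imp_permutation[rotated]) simp
  \<comment> \<open>Orbits of a permutation are symmetric, so \<open>Suc m\<close> in turn reaches
    every point.\<close>
  have "x \<in> orbit p (Suc m)" if "x \<in> {1..Suc m}" for x
  proof (cases "x = Suc m")
    case False
    then have "x \<in> {1..m}" using that by auto
    then show ?thesis using orbit_swap[OF permutation_self_in_orbit[OF perm] reach] by blast
  qed (use permutation_self_in_orbit[OF perm] in simp)
  moreover have "orbit p (Suc m) \<subseteq> {1..Suc m}" using permutes_orbit_subset[OF p] by simp
  ultimately have "{1..Suc m} = orbit p (Suc m)" by blast
  then have "cyclic_on p {1..Suc m}" by (rule cyclic_on_singleI[rotated]) simp
  moreover have "arcs m p = E"
  proof
    show "arcs m p \<subseteq> E" using in_E top by (auto simp: arcs_def)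
    show "E \<subseteq> arcs m p" using pE C(1) by (fastforce simp: arcs_def)
  qed
  ultimately show ?thesis using p that by blast
qed

text \<open>The bijection is \<open>arcs m\<close>. For \<open>m = 0\<close> the identity would be
  counted on the left, with no path on the right.\<close>

lemma card_cyclic_sorted_excedances:
  assumes "m > 0"
  shows "card {p. p permutes {1..Suc m} \<and> cyclic_on p {1..Suc m} \<and>
    sorted_wrt (<) (excedances (Suc m) p)} = card (open_paths m 1)"
    (is "card ?S = _")
proof (rule bij_betw_same_card[of "arcs m"])
  have "arcs m p \<in> open_paths m 1" if "p \<in> ?S" for p
  proof -
    from that have p: "p permutes {1..Suc m}" "cyclic_on p {1..Suc m}" by auto
    have "p (Suc m) \<noteq> Suc m"
    proof
      assume fp: "p (Suc m) = Suc m"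
      \<comment> \<open>A fixed point has a one-point orbit, which would miss
        \<open>1\<close>.\<close>
      have "y = Suc m" if "y \<in> orbit p (Suc m)" for y using that by induct (simp_all add: fp)
      moreover have "1 \<in> orbit p (Suc m)" using p(2) by (auto simp: cyclic_on_alldef)
      ultimately show False using assms by auto
    qed
    moreover have "arcs m p \<in> path_systems m"
      unfolding path_systems_def
      using arcs_subset[OF p(1)] single_valued_arcs acyclic_arcs[OF p] that
        single_valued_converse_arcs[OF permutes_inj[OF p(1)]] arcs_nonnesting_iff[OF p(1)] by simp
    ultimately show ?thesis using card_arcs[OF p(1)] by (simp add: open_paths_def)
  qed
  moreover have "E \<in> arcs m ` ?S" if E: "E \<in> open_paths m 1" for E
  proof -
    obtain p where p: "p permutes {1..Suc m}" "cyclic_on p {1..Suc m}" "arcs m p = E"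
      using arcs_surj[OF E] .
    moreover have "sorted_wrt (<) (excedances (Suc m) p)"
      unfolding arcs_nonnesting_iff[OF p(1)] using E p(3) by (simp add: open_paths_def path_systems_def)
    ultimately show ?thesis by blast
  qed
  moreover have "inj_on (arcs m) ?S" using arcs_inject by (intro inj_onI) auto
  ultimately show "bij_betw (arcs m) ?S (open_paths m 1)" unfolding bij_betw_def by blast
qed

theorem theorem3:
  fixes n :: nat
  assumes "n \<ge> 1"
  shows "card {p. p permutes {1..n} \<and> cyclic_on p {1..n} \<and>
                  sorted_wrt (<) (excedances n p)} = bell (n - 1)"
proof (cases "n = 1")
  case True
  \<comment> \<open>For \<open>n = 1\<close> no path remains after deleting the largest point, so
    the identity is counted directly.\<close>
  have "cyclic_on id {1::nat}"
  proof -
    have "y = 1" if "y \<in> orbit id (1::nat)" for y using that by induct simp_all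
    then show ?thesis using orbit.base[of id "1::nat"] by (auto simp: cyclic_on_def)
  qed
  then have "{p. p permutes {1..n} \<and> cyclic_on p {1..n} \<and> sorted_wrt (<) (excedances n p)} = {id}"
    using True by (auto simp: excedances_def permutes_sing)
  moreover have "Collect (partition_on {}) = {{} :: nat set set}" by (auto simp: partition_on_empty)
  ultimately show ?thesis using True by (simp add: bell_def)
next
  case False
  then obtain m where "n = Suc m" "m > 0" using assms by (cases n) auto
  then show ?thesis using card_cyclic_sorted_excedances[of m] card_open_paths_1[of m] by simp
qed

end
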